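(* Let $T_1,T_2$ be $2\times2$ matrices with entries in $\{0,1\}$, neither having a zero row, and let $F$ be the associated recurrence system. Then $F$ is of at least one of the following four types: zero entropy type, equal growth type, dominating type, or oscillating type.
   Context: Let $\alpha_i=T_1^{(i)}\otimes T_2^{(i)}$ ($i=1,2$), where $T_k^{(i)}$ is the $i$-th row of $T_k$ and $(v_1,v_2)\otimes(w_1,w_2)=(v_1w_1,v_1w_2,v_2w_1,v_2w_2)$; $|\alpha_i|$ is the number of ones in $\alpha_i$. The recurrence system $F$: $\gamma^{[s_j]}_{i,0}=1$ and for $n\ge1$ $$\gamma^{[s_1]}_{i,n}=\sum_{j,k=1}^2T_1(i,j)T_2(i,k)\,\gamma^{[s_1]}_{j,n-1}\gamma^{[s_2]}_{k,n-1},\qquad \gamma^{[s_2]}_{i,n}=\sum_{j=1}^2T_1(i,j)\,\gamma^{[s_1]}_{j,n-1}.$$ (This describes the numbers of admissible blocks of the $G$-vertex shift with adjacency matrices $T$ on $G=\langle s_1,s_2\mid s_2s_2=s_2\rangle$.) Types: $F$ is of zero entropy type if $|\alpha_1|=|\alpha_2|=1$; of equal growth type if $|\alpha_1|=|\alpha_2|$. The items of $\gamma^{[s_1]}_{i,n}$ are the products $\gamma^{[s_1]}_{j,n-1}\gamma^{[s_2]}_{k,n-1}$ for pairs $(j,k)$ with $T_1(i,j)T_2(i,k)=1$; the items of $\gamma^{[s_2]}_{i,n}$ are the terms $\gamma^{[s_1]}_{j,n-1}$ for $j$ with $T_1(i,j)=1$; write $\gamma^{[s_j]}_{i,n}=\sum_l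 f^{ij}_{l,n-1}$. $\gamma^{[s_j]}_{i,n}$ has a dominate item if there is an index $r$ with $f^{ij}_{r,n}\ge f^{ij}_{l,n}$ for all indices $l\ne r$ and all $n\ge1$; $F$ is of dominating type if all four of $\gamma^{[s_1]}_{1,n},\gamma^{[s_1]}_{2,n},\gamma^{[s_2]}_{1,n},\gamma^{[s_2]}_{2,n}$ have a dominate item. $F$ is of oscillating type if there are two (infinite) sequences $\{m^1_n\},\{m^2_n\}$ of positive integers with disjoint ranges whose union is $\mathbb{N}$, such that $\gamma^{[s_1]}_{1,n}\ge\gamma^{[s_1]}_{2,n}$ for $n\in\{m^1_n\}$ and $\gamma^{[s_1]}_{1,n}<\gamma^{[s_1]}_{2,n}$ for $n\in\{m^2_n\}$. *)

theory Defs
  imports Main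
begin

text \<open>A 2x2 matrix is modelled as a function nat => nat => nat, with rows/columns
indexed by 1 and 2. gam T1 T2 n i = (gamma^[s1]_{i,n}, gamma^[s2]_{i,n}).\<close>

definition zero_one_mat :: "(nat \<Rightarrow> nat \<Rightarrow> nat) \<Rightarrow> bool" where
  "zero_one_mat T \<longleftrightarrow> (\<forall>i\<in>{1,2}. \<forall>j\<in>{1,2}. T i j \<in> {0,1})"

definition no_zero_row :: "(nat \<Rightarrow> nat \<Rightarrow> nat) \<Rightarrow> bool" where
  "no_zero_row T \<longleftrightarrow> (\<forall>i\<in>{1,2}. \<exists>j\<in>{1,2}. T i j \<noteq> 0)"

fun gam :: "(nat \<Rightarrow> nat \<Rightarrow> nat) \<Rightarrow> (nat \<Rightarrow> nat \<Rightarrow> nat) \<Rightarrow> nat \<Rightarrow> nat \<Rightarrow> nat \<times> nat" where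
  "gam T1 T2 0 i = (1, 1)"
| "gam T1 T2 (Suc n) i =
     ((\<Sum>j\<in>{1,2}. \<Sum>k\<in>{1,2}. T1 i j * T2 i k * fst (gam T1 T2 n j) * snd (gam T1 T2 n k)),
      (\<Sum>j\<in>{1,2}. T1 i j * fst (gam T1 T2 n j)))"

definition gam1 where "gam1 T1 T2 i n = fst (gam T1 T2 n i)"
definition gam2 where "gam2 T1 T2 i n = snd (gam T1 T2 n i)"

text \<open>|alpha_i| = number of ones of T1^(i) (x) T2^(i)\<close>
definition alpha_card :: "(nat \<Rightarrow> nat \<Rightarrow> nat) \<Rightarrow> (nat \<Rightarrow> nat \<Rightarrow> nat) \<Rightarrow> nat \<Rightarrow> nat" where
  "alpha_card T1 T2 i = card {(j,k). j \<in> {1,2} \<and> k \<in> {1,2} \<and> T1 i j * T2 i k = 1}"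

definition zero_entropy_type :: "(nat \<Rightarrow> nat \<Rightarrow> nat) \<Rightarrow> (nat \<Rightarrow> nat \<Rightarrow> nat) \<Rightarrow> bool" where
  "zero_entropy_type T1 T2 \<longleftrightarrow> alpha_card T1 T2 1 = 1 \<and> alpha_card T1 T2 2 = 1"

definition equal_growth_type :: "(nat \<Rightarrow> nat \<Rightarrow> nat) \<Rightarrow> (nat \<Rightarrow> nat \<Rightarrow> nat) \<Rightarrow> bool" where
  "equal_growth_type T1 T2 \<longleftrightarrow> alpha_card T1 T2 1 = alpha_card T1 T2 2"

definition has_dominate_item :: "'l set \<Rightarrow> ('l \<Rightarrow> nat \<Rightarrow> nat) \<Rightarrow> bool" where
  "has_dominate_item L f \<longleftrightarrow> (\<exists>r\<in>L. \<forall>l\<in>L. l \<noteq> r \<longrightarrow> (\<forall>n\<ge>1. f r n \<ge> f l n))"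

definition items1_idx where
  "items1_idx T1 T2 i = {(j,k). j \<in> {1,2} \<and> k \<in> {1,2} \<and> T1 i j * T2 i k = 1}"
definition items1 where
  "items1 T1 T2 = (\<lambda>(j,k) n. gam1 T1 T2 j n * gam2 T1 T2 k n)"
definition items2_idx where
  "items2_idx T1 i = {j. j \<in> {1,2} \<and> T1 i j = 1}"
definition items2 where
  "items2 T1 T2 = (\<lambda>j n. gam1 T1 T2 j n)"

definition dominating_type :: "(nat \<Rightarrow> nat \<Rightarrow> nat) \<Rightarrow> (nat \<Rightarrow> nat \<Rightarrow> nat) \<Rightarrow> bool" where
  "dominating_type T1 T2 \<longleftrightarrow>
     (\<forall>i\<in>{1,2}. has_dominate_item (items1_idx T1 T2 i) (items1 T1 T2)
               \<and> has_dominate_item (items2_idx T1 i) (items2 T1 T2))"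

definition oscillating_type :: "(nat \<Rightarrow> nat \<Rightarrow> nat) \<Rightarrow> (nat \<Rightarrow> nat \<Rightarrow> nat) \<Rightarrow> bool" where
  "oscillating_type T1 T2 \<longleftrightarrow>
     (\<exists>(m1::nat \<Rightarrow> nat) (m2::nat \<Rightarrow> nat). strict_mono m1 \<and> strict_mono m2 \<and>
        (\<forall>n. m1 n \<ge> 1) \<and> (\<forall>n. m2 n \<ge> 1) \<and>
        range m1 \<inter> range m2 = {} \<and> range m1 \<union> range m2 = {1::nat..} \<and>
        (\<forall>n\<in>range m1. gam1 T1 T2 1 n \<ge> gam1 T1 T2 2 n) \<and>
        (\<forall>n\<in>range m2. gam1 T1 T2 1 n < gam1 T1 T2 2 n))"

end

theory Submission
  imports Defs "HOL-Library.Infinite_Set"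
begin

text \<open>
  If \<open>\<gamma>\<^sup>[\<^sup>s\<^sup>1\<^sup>]\<^sub>1 - \<gamma>\<^sup>[\<^sup>s\<^sup>1\<^sup>]\<^sub>2\<close> has a constant weak sign, then so has \<open>\<gamma>\<^sup>[\<^sup>s\<^sup>2\<^sup>]\<^sub>1 - \<gamma>\<^sup>[\<^sup>s\<^sup>2\<^sup>]\<^sub>2\<close>, and all items
  are compared factor by factor: the system is of dominating type. If the sign changes infinitely
  often, the system is oscillating. When \<open>\<bar>\<alpha>\<^sub>1\<bar> < \<bar>\<alpha>\<^sub>2\<bar>\<close>, the constant sign is immediate unless
  the matrices are one of a few pairs. Eliminating \<open>\<gamma>\<^sup>[\<^sup>s\<^sup>2\<^sup>]\<close> there leaves a second-order recurrence
  for the ratio of \<open>\<gamma>\<^sup>[\<^sup>s\<^sup>1\<^sup>]\<^sub>1\<close> and \<open>\<gamma>\<^sup>[\<^sup>s\<^sup>1\<^sup>]\<^sub>2\<close>, whose position relative to 1 is decided by elementary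
  inequalities between a few consecutive terms.
\<close>

definition one_signed :: "(nat \<Rightarrow> nat) \<Rightarrow> (nat \<Rightarrow> nat) \<Rightarrow> bool" where
  "one_signed a b \<longleftrightarrow> (\<forall>n\<ge>1. a n \<le> b n) \<or> (\<forall>n\<ge>1. b n \<le> a n)"

text \<open>Strictness on both sides makes the notion symmetric in the two sequences, so the two
  states can be exchanged.\<close>

definition sign_changing :: "(nat \<Rightarrow> nat) \<Rightarrow> (nat \<Rightarrow> nat) \<Rightarrow> bool" where
  "sign_changing a b \<longleftrightarrow> (\<exists>\<^sub>\<infinity>n. a n < b n) \<and> (\<exists>\<^sub>\<infinity>n. b n < a n)"

lemma one_signed_commute: "one_signed a b \<longleftrightarrow> one_signed b a"
  by (auto simp: one_signed_def)

lemma sign_changing_commute: "sign_changing a b \<longleftrightarrow> sign_changing b a"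
  by (auto simp: sign_changing_def)

lemma one_signedI_Suc: "(\<And>n. a (Suc n) \<le> b (Suc n)) \<Longrightarrow> one_signed a b"
  unfolding one_signed_def by (metis One_nat_def Suc_le_D)

lemma sign_changingI:
  assumes "\<And>n. \<exists>m\<ge>n. a m < b m" and "\<And>n. \<exists>m\<ge>n. b m < a m"
  shows "sign_changing a b"
  using assms unfolding sign_changing_def INFM_nat_le by blast

subsection \<open>Second-order recurrences\<close>

text \<open>The ratio \<open>x = 1 + b / a\<close> satisfies \<open>x\<^sub>n\<^sub>+\<^sub>2 = 1 + x\<^sub>n\<^sub>+\<^sub>1 / x\<^sub>n\<close>, with fixed point 2.\<close>

lemma sign_changing_spiral:
  fixes a b :: "nat \<Rightarrow> nat"
  assumes pos: "\<And>n. 0 < a n" "\<And>n. 0 < b n"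
    and a: "\<And>n. a (Suc (Suc n)) = a (Suc n) * (a n + b n)"
    and b: "\<And>n. b (Suc (Suc n)) = (a (Suc n) + b (Suc n)) * a n"
    and init: "a 1 \<noteq> b 1"
  shows "sign_changing a b"
proof -
  \<comment> \<open>Two consecutive ties would propagate backwards to indices 0 and 1, against
    \<open>init\<close>.\<close>
  have nondeg: "a n \<noteq> b n \<or> a (Suc n) \<noteq> b (Suc n)" for n
  proof (induction n)
    case 0
    then show ?case using init by simp
  next
    case (Suc n)
    show ?case
    proof (rule ccontr)
      assume "\<not> ?thesis"
      then have e: "a (Suc n) = b (Suc n)" "a (Suc (Suc n)) = b (Suc (Suc n))" by auto
      then have "a (Suc n) * (a n + b n) = a (Suc n) * (2 * a n)"
        by (simp add: a b algebra_simps)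
      then have "a n = b n" using pos(1)[of "Suc n"] by (simp del: mult_Suc_right)
      then show False using Suc e by simp
    qed
  qed
  \<comment> \<open>Three steps reverse the sign: if \<open>b / a\<close> stays on one side of 1 at
    two consecutive indices, not both ties, it is strictly on the other side at
    \<open>n + 3\<close>.\<close>
  have step: "b (n+3) \<ge> a (n+3) \<longleftrightarrow> b n * b (Suc n) \<le> a n * a (Suc n)"
    and step': "b (n+3) \<le> a (n+3) \<longleftrightarrow> b n * b (Suc n) \<ge> a n * a (Suc n)" for n
  proof -
    have n3: "n + 3 = Suc (Suc (Suc n))" by simp
    have A: "a (n+3) = a (Suc n) * ((a n + b n) * (a (Suc n) + b (Suc n)))"
      unfolding n3 a[of "Suc n"] a[of n] by (simp add: algebra_simps)
    have B: "b (n+3) = a (Suc n) * (a (Suc n) * (a n + b n) + (a (Suc n) + b (Suc n)) * a n)"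
      unfolding n3 b[of "Suc n"] a[of n] b[of n] by (simp add: algebra_simps)
    show "b (n+3) \<ge> a (n+3) \<longleftrightarrow> b n * b (Suc n) \<le> a n * a (Suc n)"
      unfolding A B using pos(1)[of "Suc n"] by (simp add: algebra_simps)
    show "b (n+3) \<le> a (n+3) \<longleftrightarrow> b n * b (Suc n) \<ge> a n * a (Suc n)"
      unfolding A B using pos(1)[of "Suc n"] by (simp add: algebra_simps)
  qed
  have strict: "x * y < x' * y'"
    if "x \<le> x'" "y \<le> y'" "x \<noteq> x' \<or> y \<noteq> y'" "0 < x" "0 < y" for x y x' y' :: nat
    using that by (metis le_neq_implies_less mult_less_le_imp_less mult_le_less_imp_less
        less_le_trans zero_le order_less_imp_le)
  show ?thesis
  proof (rule sign_changingI)
    fix n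
    show "\<exists>m\<ge>n. a m < b m"
    proof (rule ccontr)
      assume "\<not> ?thesis"
      then have le: "b m \<le> a m" if "m \<ge> n" for m using that by (auto simp: not_less)
      have "b n * b (Suc n) < a n * a (Suc n)"
        using strict[of "b n" "a n" "b (Suc n)" "a (Suc n)"] le[of n] le[of "Suc n"]
          nondeg[of n] pos by auto
      with step'[of n] le[of "n+3"] show False by simp
    qed
    show "\<exists>m\<ge>n. b m < a m"
    proof (rule ccontr)
      assume "\<not> ?thesis"
      then have le: "a m \<le> b m" if "m \<ge> n" for m using that by (auto simp: not_less)
      have "a n * a (Suc n) < b n * b (Suc n)"
        using strict[of "a n" "b n" "a (Suc n)" "b (Suc n)"] le[of n] le[of "Suc n"]
          nondeg[of n] pos by auto
      with step[of n] le[of "n+3"] show False by simp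
    qed
  qed
qed

lemma sign_changing_alternating:
  assumes "P N"
    and "\<And>n. P n \<Longrightarrow> b n < a n \<and> a (Suc n) < b (Suc n) \<and> P (Suc (Suc n))"
  shows "sign_changing a b"
proof -
  have P: "P (N + 2 * k)" for k
    by (induction k) (use assms in auto)
  show ?thesis
  proof (rule sign_changingI)
    fix n
    show "\<exists>m\<ge>n. a m < b m"
      using assms(2)[OF P[of n]] by (intro exI[of _ "Suc (N + 2 * n)"]) simp
    show "\<exists>m\<ge>n. b m < a m"
      using assms(2)[OF P[of n]] by (intro exI[of _ "N + 2 * n"]) simp
  qed
qed

text \<open>The ratio \<open>s = a / b\<close> satisfies \<open>s\<^sub>n\<^sub>+\<^sub>2 = (1 + s\<^sub>n) / (1 + s\<^sub>n\<^sub>+\<^sub>1)\<close>.\<close>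

lemma sign_changing_flip:
  fixes a b :: "nat \<Rightarrow> nat"
  assumes pos: "\<And>n. 0 < a n" "\<And>n. 0 < b n"
    and a: "\<And>n. a (Suc (Suc n)) = b (Suc n) * (a n + b n)"
    and b: "\<And>n. b (Suc (Suc n)) = (a (Suc n) + b (Suc n)) * b n"
    and init: "a 0 = b 0" "a 1 < b 1"
  shows "sign_changing a b"
proof -
  have gt: "b (Suc (Suc n)) < a (Suc (Suc n)) \<longleftrightarrow> a (Suc n) * b n < b (Suc n) * a n"
    and lt: "a (Suc (Suc n)) < b (Suc (Suc n)) \<longleftrightarrow> b (Suc n) * a n < a (Suc n) * b n" for n
    by (simp_all add: a b algebra_simps)
  \<comment> \<open>Equality at \<open>n\<close> is allowed because the run starts from the tie at
    0.\<close>
  have up: "b (Suc (Suc n)) < a (Suc (Suc n))" if "b n \<le> a n" "a (Suc n) < b (Suc n)" for n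
    unfolding gt using that pos by (intro mult_less_le_imp_less) auto
  have down: "a (Suc (Suc n)) < b (Suc (Suc n))" if "a n < b n" "b (Suc n) < a (Suc n)" for n
    unfolding lt using that pos by (intro mult_strict_mono) auto
  let ?P = "\<lambda>n. b n < a n \<and> a (Suc n) < b (Suc n)"
  show ?thesis
  proof (rule sign_changing_alternating[where P = ?P and N = 2])
    show "?P 2"
      using up[of 0] down[of 1] init by (simp add: numeral_2_eq_2)
    show "b n < a n \<and> a (Suc n) < b (Suc n) \<and> ?P (Suc (Suc n))" if "?P n" for n
      using that up[of n] down[of "Suc n"] by simp
  qed
qed

text \<open>
  The ratio \<open>r = a / b\<close> satisfies \<open>r\<^sub>n\<^sub>+\<^sub>2 = r\<^sub>n / (r\<^sub>n\<^sub>+\<^sub>1 (1 + r\<^sub>n))\<close>; its fixed point is unstable and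
  different from 1, hence the asymmetric invariant.
\<close>

lemma sign_changing_unstable:
  fixes a b :: "nat \<Rightarrow> nat"
  assumes pos: "\<And>n. 0 < a n" "\<And>n. 0 < b n"
    and a: "\<And>n. a (Suc (Suc n)) = b (Suc n) * a n"
    and b: "\<And>n. b (Suc (Suc n)) = a (Suc n) * (a n + b n)"
    and init: "a 0 = 1" "b 0 = 1" "a 1 = 1" "b 1 = 2"
  shows "sign_changing a b"
proof -
  \<comment> \<open>The factor 2 absorbs \<open>a n + b n < 2 * a n\<close> in the recurrence for
    \<open>b\<close>. Index 4 is the first with \<open>b < a\<close>.\<close>
  let ?P = "\<lambda>n. b n < a n \<and> 2 * a (Suc n) \<le> b (Suc n)"
  show ?thesis
  proof (rule sign_changing_alternating[where P = ?P and N = 4])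
    show "?P 4"
      using init by (simp add: eval_nat_numeral a b)
    show "b n < a n \<and> a (Suc n) < b (Suc n) \<and> ?P (Suc (Suc n))" if P: "?P n" for n
    proof -
      have "b (Suc (Suc n)) < a (Suc n) * (2 * a n)"
        unfolding b using P pos by simp
      also have "\<dots> \<le> a (Suc (Suc n))"
        unfolding a using P mult_le_mono1[of "2 * a (Suc n)" "b (Suc n)" "a n"] by (simp add: ac_simps)
      finally have 1: "b (Suc (Suc n)) < a (Suc (Suc n))" .
      have "2 * a (Suc (Suc (Suc n))) = b (Suc (Suc n)) * (2 * a (Suc n))"
        by (simp add: a[of "Suc n"])
      also have "\<dots> \<le> a (Suc (Suc n)) * (a (Suc n) + b (Suc n))"
        using P 1 by (intro mult_le_mono) auto
      also have "\<dots> = b (Suc (Suc (Suc n)))" by (simp add: b[of "Suc n"])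
      finally show ?thesis using P 1 pos(1)[of "Suc n"] by auto
    qed
  qed
qed

text \<open>
  The ratio \<open>r = a / b\<close> satisfies \<open>r\<^sub>n\<^sub>+\<^sub>2 = 1 / (r\<^sub>n\<^sub>+\<^sub>1 (1 + r\<^sub>n))\<close>, so \<open>r\<^sub>n\<^sub>+\<^sub>3 \<le> 1\<close> if and only if
  \<open>r\<^sub>n r\<^sub>n\<^sub>+\<^sub>1 \<le> 1\<close>.
\<close>

lemma le_of_reciprocal_recurrence:
  fixes a b :: "nat \<Rightarrow> nat"
  assumes a: "\<And>n. a (Suc (Suc n)) = b (Suc n) * b n"
    and b: "\<And>n. b (Suc (Suc n)) = a (Suc n) * (a n + b n)"
    and init: "a 0 = 1" "b 0 = 1" "a 1 = 1" "b 1 = 2"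
  shows "a n \<le> b n"
proof -
  have step: "a (Suc (Suc (Suc n))) \<le> b (Suc (Suc (Suc n)))"
    if "a n \<le> b n" "a (Suc n) \<le> b (Suc n)" for n
  proof -
    have "a (Suc (Suc (Suc n))) = b (Suc n) * (a n * a (Suc n) + a (Suc n) * b n)"
      by (simp add: a[of "Suc n"] b[of n] algebra_simps)
    also have "\<dots> \<le> b (Suc n) * (b n * b (Suc n) + a (Suc n) * b n)"
      using that by (intro mult_le_mono add_mono) auto
    also have "\<dots> = b (Suc (Suc (Suc n)))"
      by (simp add: b[of "Suc n"] a[of n] algebra_simps)
    finally show ?thesis .
  qed
  have "a n \<le> b n \<and> a (Suc n) \<le> b (Suc n) \<and> a (Suc (Suc n)) \<le> b (Suc (Suc n))"
    by (induction n) (use init a[of 0] b[of 0] step in auto)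
  then show ?thesis by simp
qed

subsection \<open>The dichotomy for two-state systems\<close>

text \<open>Rows \<open>(p, q)\<close>, \<open>(r, s)\<close> belong to \<open>T\<^sub>1\<close> and rows \<open>(t, u)\<close>, \<open>(v, w)\<close> to \<open>T\<^sub>2\<close>.\<close>

locale two_state_system =
  fixes p q r s t u v w :: nat and a b c d :: "nat \<Rightarrow> nat"
  assumes rows:
      "(p, q) \<in> {(1, 0), (0, 1), (1, 1)}" "(r, s) \<in> {(1, 0), (0, 1), (1, 1)}"
      "(t, u) \<in> {(1, 0), (0, 1), (1, 1)}" "(v, w) \<in> {(1, 0), (0, 1), (1, 1)}"
    and init: "a 0 = 1" "b 0 = 1" "c 0 = 1" "d 0 = 1"
    and a_Suc: "\<And>n. a (Suc n) = (p * a n + q * b n) * (t * c n + u * d n)"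
    and b_Suc: "\<And>n. b (Suc n) = (r * a n + s * b n) * (v * c n + w * d n)"
    and c_Suc: "\<And>n. c (Suc n) = p * a n + q * b n"
    and d_Suc: "\<And>n. d (Suc n) = r * a n + s * b n"
begin

text \<open>Exchanging the states reverses rows and columns of both matrices, so one order of the
  row counts suffices.\<close>

lemma swapped: "two_state_system s r q p w v u t b a d c"
  using rows init
  by unfold_locales (auto simp: a_Suc b_Suc c_Suc d_Suc add.commute)

lemma pos: "0 < a n" "0 < b n" "0 < c n" "0 < d n"
proof -
  have "0 < a n \<and> 0 < b n \<and> 0 < c n \<and> 0 < d n"
    by (induction n) (use rows init in \<open>auto simp: a_Suc b_Suc c_Suc d_Suc\<close>)
  then show "0 < a n" "0 < b n" "0 < c n" "0 < d n" by auto
qed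

lemma one_signed_second:
  assumes "one_signed a b"
  shows "one_signed c d"
proof -
  \<comment> \<open>The values at 1 of \<open>c\<close> and \<open>d\<close> depend on index 0,
    which \<open>one_signed\<close> omits; the initial tie fills it in.\<close>
  have le: "a n \<le> b n" if "\<forall>n\<ge>1. a n \<le> b n" for n
    using that init by (cases n) auto
  have ge: "b n \<le> a n" if "\<forall>n\<ge>1. b n \<le> a n" for n
    using that init by (cases n) auto
  consider "\<And>n. a n \<le> b n" | "\<And>n. b n \<le> a n"
    using assms le ge unfolding one_signed_def by blast
  then have "(\<forall>n. c (Suc n) \<le> d (Suc n)) \<or> (\<forall>n. d (Suc n) \<le> c (Suc n))"
    by cases (use rows in \<open>auto simp: c_Suc d_Suc\<close>)
  then show ?thesis
    using one_signedI_Suc one_signed_commute by metis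
qed

lemma dichotomy_less:
  assumes less: "(p + q) * (t + u) < (r + s) * (v + w)"
  shows "one_signed a b \<or> sign_changing a b"
proof -
  \<comment> \<open>If both second rows are full, \<open>entrywise\<close> holds. Otherwise the
    counts are 1 and 2: the full row is the second of one matrix, and outside
    \<open>entrywise\<close> the single ones of the other matrix lie in different columns.\<close>
  consider
      (entrywise) "p \<le> r" "q \<le> s" "t \<le> v" "u \<le> w"
    | (aligned) "p + q = 1" "r = 1" "s = 1" "t = 1" "u = 0" "v = 0" "w = 1"
    | (spiral) "p = 1" "q = 0" "r = 1" "s = 1" "t = 0" "u = 1" "v = 1" "w = 0"
    | (flip) "p = 0" "q = 1" "r = 1" "s = 1" "t = 0" "u = 1" "v = 1" "w = 0"
    | (diagonal) "p = 1" "q = 0" "r = 0" "s = 1" "t + u = 1" "v = 1" "w = 1"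
    | (reciprocal) "p = 0" "q = 1" "r = 1" "s = 0" "t = 1" "u = 0" "v = 1" "w = 1"
    | (unstable) "p = 0" "q = 1" "r = 1" "s = 0" "t = 0" "u = 1" "v = 1" "w = 1"
    using rows less by auto
  then show ?thesis
  proof cases
    case entrywise
    then have "a (Suc n) \<le> b (Suc n)" for n
      unfolding a_Suc b_Suc by (intro mult_le_mono add_mono) auto
    then show ?thesis using one_signedI_Suc by blast
  next
    case aligned
    have cd: "c n \<le> d n" for n
      using aligned init by (cases n) (auto simp: c_Suc d_Suc add_is_1)
    have "a (Suc n) \<le> b (Suc n)" for n
      unfolding a_Suc b_Suc using aligned cd[of n]
      by (intro mult_le_mono) (auto simp: add_is_1)
    then show ?thesis using one_signedI_Suc by blast
  next
    case spiral
    have "sign_changing a b"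
      by (rule sign_changing_spiral) (use spiral pos init in \<open>simp_all add: a_Suc b_Suc c_Suc d_Suc\<close>)
    then show ?thesis ..
  next
    case flip
    have "sign_changing a b"
      by (rule sign_changing_flip) (use flip pos init in \<open>simp_all add: a_Suc b_Suc c_Suc d_Suc\<close>)
    then show ?thesis ..
  next
    case diagonal
    have "a n \<le> b n" for n
    proof (induction n)
      case 0
      then show ?case using init by simp
    next
      case (Suc n)
      then show ?case
        unfolding a_Suc b_Suc using diagonal
        by (intro mult_le_mono) (auto simp: add_is_1)
    qed
    then show ?thesis using one_signedI_Suc by blast
  next
    case reciprocal
    have "a n \<le> b n" for n
      by (rule le_of_reciprocal_recurrence)
        (use reciprocal init in \<open>simp_all add: a_Suc b_Suc c_Suc d_Suc algebra_simps\<close>)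
    then show ?thesis using one_signedI_Suc by blast
  next
    case unstable
    have "sign_changing a b"
      by (rule sign_changing_unstable)
        (use unstable pos init in \<open>simp_all add: a_Suc b_Suc c_Suc d_Suc algebra_simps\<close>)
    then show ?thesis ..
  qed
qed

lemma dichotomy:
  assumes "(p + q) * (t + u) \<noteq> (r + s) * (v + w)"
  shows "one_signed a b \<or> sign_changing a b"
  using assms dichotomy_less two_state_system.dichotomy_less[OF swapped]
    one_signed_commute[of a b] sign_changing_commute[of a b]
  by (metis add.commute linorder_neqE_nat)

end

subsection \<open>Growth types\<close>

lemma oscillating_type_if_sign_changing:
  assumes "sign_changing (gam1 T1 T2 1) (gam1 T1 T2 2)"
  shows "oscillating_type T1 T2"
proof -
  \<comment> \<open>Ties go to \<open>?A\<close>, so that the two sets partition the positive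
    integers.\<close>
  let ?A = "{n. n \<ge> 1 \<and> gam1 T1 T2 2 n \<le> gam1 T1 T2 1 n}"
  let ?B = "{n. n \<ge> 1 \<and> gam1 T1 T2 1 n < gam1 T1 T2 2 n}"
  have inf: "\<exists>n>m. gam1 T1 T2 1 n < gam1 T1 T2 2 n" "\<exists>n>m. gam1 T1 T2 2 n < gam1 T1 T2 1 n" for m
    using assms unfolding sign_changing_def INFM_nat by blast+
  have A: "infinite ?A"
    unfolding infinite_nat_iff_unbounded using inf(2) by fastforce
  have B: "infinite ?B"
    unfolding infinite_nat_iff_unbounded using inf(1) by fastforce
  show ?thesis
    unfolding oscillating_type_def
  proof (intro exI conjI)
    show "strict_mono (enumerate ?A)" "strict_mono (enumerate ?B)"
      using A B by (auto intro: strict_mono_enumerate)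
  qed (use range_enumerate[OF A] range_enumerate[OF B] enumerate_in_set[OF A]
      enumerate_in_set[OF B] in auto)
qed

lemma one_signed_dominant:
  assumes "one_signed (f 1) (f 2)" and "S \<subseteq> {1, 2::nat}" and "S \<noteq> {}"
  obtains m where "m \<in> S" "\<And>l n. l \<in> S \<Longrightarrow> n \<ge> 1 \<Longrightarrow> f l n \<le> f m n"
proof -
  consider "S = {1}" | "S = {2}" | "S = {1, 2}"
    using assms(2,3) by blast
  then show ?thesis
    by cases (use assms(1) that in \<open>auto simp: one_signed_def\<close>)
qed

lemma dominating_type_if_one_signed:
  assumes "zero_one_mat T1" "zero_one_mat T2" "no_zero_row T1" "no_zero_row T2"
    and g1: "one_signed (gam1 T1 T2 1) (gam1 T1 T2 2)"
    and g2: "one_signed (gam2 T1 T2 1) (gam2 T1 T2 2)"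
  shows "dominating_type T1 T2"
  unfolding dominating_type_def
proof
  fix i :: nat
  assume i: "i \<in> {1, 2}"
  let ?S = "\<lambda>T. {j. j \<in> {1, 2::nat} \<and> T i j = (1::nat)}"
  have ne: "?S T \<noteq> {}" if "zero_one_mat T" "no_zero_row T" for T
    using that i unfolding zero_one_mat_def no_zero_row_def by fastforce
  obtain m where m: "m \<in> ?S T1" "\<And>l n. l \<in> ?S T1 \<Longrightarrow> n \<ge> 1 \<Longrightarrow> gam1 T1 T2 l n \<le> gam1 T1 T2 m n"
    by (rule one_signed_dominant[OF g1, of "?S T1"]) (use ne assms in auto)
  obtain k where k: "k \<in> ?S T2" "\<And>l n. l \<in> ?S T2 \<Longrightarrow> n \<ge> 1 \<Longrightarrow> gam2 T1 T2 l n \<le> gam2 T1 T2 k n"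
    by (rule one_signed_dominant[OF g2, of "?S T2"]) (use ne assms in auto)
  \<comment> \<open>The items form a product set, so the best factors \<open>m\<close> and
    \<open>k\<close> can be chosen independently.\<close>
  have idx: "items1_idx T1 T2 i = ?S T1 \<times> ?S T2"
    by (auto simp: items1_idx_def)
  have "has_dominate_item (items1_idx T1 T2 i) (items1 T1 T2)"
    unfolding has_dominate_item_def idx items1_def
    by (rule bexI[of _ "(m, k)"]) (use m k in \<open>auto intro!: mult_le_mono\<close>)
  moreover have "has_dominate_item (items2_idx T1 i) (items2 T1 T2)"
    unfolding has_dominate_item_def items2_idx_def items2_def
    by (rule bexI[of _ m]) (use m in auto)
  ultimately show "has_dominate_item (items1_idx T1 T2 i) (items1 T1 T2) \<and>
      has_dominate_item (items2_idx T1 i) (items2 T1 T2)" ..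
qed

lemma zero_one_row:
  assumes "zero_one_mat T" "no_zero_row T" "i \<in> {1, 2}"
  shows "(T i 1, T i 2) \<in> {(1, 0), (0, 1), (1, 1)}"
  using assms unfolding zero_one_mat_def no_zero_row_def by fastforce

lemma alpha_card_eq:
  assumes "zero_one_mat T1" "zero_one_mat T2" "i \<in> {1, 2}"
  shows "alpha_card T1 T2 i = (T1 i 1 + T1 i 2) * (T2 i 1 + T2 i 2)"
proof -
  have row: "card {j. j \<in> {1, 2} \<and> T i j = 1} = T i 1 + T i 2" if "zero_one_mat T" for T
  proof -
    have "card {j. j \<in> {1, 2} \<and> T i j = 1} = (\<Sum>j\<in>{1, 2}. if T i j = 1 then 1 else 0)"
      by (simp add: sum.If_cases Int_def conj_commute)
    also have "\<dots> = T i 1 + T i 2"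
      using that assms(3) by (auto simp: zero_one_mat_def)
    finally show ?thesis .
  qed
  have "{(j, k). j \<in> {1, 2} \<and> k \<in> {1, 2} \<and> T1 i j * T2 i k = 1} =
      {j. j \<in> {1, 2} \<and> T1 i j = 1} \<times> {k. k \<in> {1, 2} \<and> T2 i k = 1}"
    by auto
  then show ?thesis
    unfolding alpha_card_def using assms by (simp only: card_cartesian_product row)
qed

theorem theorem5:
  fixes T1 T2 :: "nat \<Rightarrow> nat \<Rightarrow> nat"
  assumes "zero_one_mat T1" and "zero_one_mat T2"
    and "no_zero_row T1" and "no_zero_row T2"
  shows "zero_entropy_type T1 T2 \<or> equal_growth_type T1 T2 \<or>
         dominating_type T1 T2 \<or> oscillating_type T1 T2"
proof (cases "equal_growth_type T1 T2")
  case False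
  interpret two_state_system "T1 1 1" "T1 1 2" "T1 2 1" "T1 2 2" "T2 1 1" "T2 1 2" "T2 2 1" "T2 2 2"
    "gam1 T1 T2 1" "gam1 T1 T2 2" "gam2 T1 T2 1" "gam2 T1 T2 2"
  proof unfold_locales
  qed (use assms zero_one_row in \<open>simp_all add: gam1_def gam2_def algebra_simps\<close>)
  have "one_signed (gam1 T1 T2 1) (gam1 T1 T2 2) \<or> sign_changing (gam1 T1 T2 1) (gam1 T1 T2 2)"
    using False assms by (intro dichotomy) (simp add: equal_growth_type_def alpha_card_eq)
  then show ?thesis
    using assms one_signed_second dominating_type_if_one_signed oscillating_type_if_sign_changing
    by blast
qed simp

end
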